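(* Let $X$ be a compact metric space and let $f:X\to X$ be a homeomorphism. Then $f$ is positively expansive if and only if $X$ is finite.
   Context: A continuous map $f:X\to X$ on a metric space $(X,d)$ is positively expansive if there exists $\rho>0$ such that for any distinct $x,y\in X$ there is an integer $n\ge 0$ with $d(f^n(x),f^n(y))>\rho$. Here $f^n$ denotes the $n$-fold iterate of $f$, with $f^0$ the identity. *)

theory Defs
  imports "HOL-Analysis.Analysis"
begin

definition positively_expansive_on :: "'a::metric_space set \<Rightarrow> ('a \<Rightarrow> 'a) \<Rightarrow> bool" where
  "positively_expansive_on X f \<longleftrightarrow>
     continuous_on X f \<and> f \<in> X \<rightarrow> X \<and>
     (\<exists>\<rho>>0. \<forall>x\<in>X. \<forall>y\<in>X. x \<noteq> y \<longrightarrow> (\<exists>n. dist ((f ^^ n) x) ((f ^^ n) y) > \<rho>))"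

end

theory Submission
  imports Defs
begin

text \<open>
  The substance is that an infinite compact space carries no positively expansive
  homeomorphism. Positive expansivity pushes points apart under forward iteration, and
  on a compact space it does so at a uniform rate: there is an \<open>N\<close> such that two orbits
  that are at least \<open>\<rho>\<close> apart are again more than \<open>\<rho>\<close> apart within the next \<open>N\<close> steps
  (\<open>recurrent_separation\<close>). This uses injectivity, since orbits that have
  merged never separate again. Hence orbits that have once been \<open>\<rho>\<close> apart cannot
  spend \<open>N\<close> consecutive steps close together. By uniform continuity there is then a
  \<open>\<delta>\<close> such that two orbits at distance less than \<open>\<delta>\<close> at time \<open>n\<close> were never more than
  \<open>\<rho>\<close> apart before (\<open>close_now_imp_close_before\<close>); in other words, all the backward
  iterates of \<open>f\<close> are equicontinuous at the scale \<open>\<rho>\<close>.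

  Compactness now bounds the number of points. Cover the space by finitely many balls of
  radius \<open>\<delta> / 2\<close> and take a finite set \<open>S\<close> with more points than there are balls.
  At a time \<open>n\<close> by which expansivity has separated all the pairs from \<open>S\<close>, two of the
  points lie in the same ball, so that they were never separated up to time \<open>n\<close>:
  a contradiction.

  Conversely, distinct points of a finite space have a positive minimal distance, so they
  are separated already at time zero.
\<close>

lemma funpow_in:
  assumes "f \<in> X \<rightarrow> X" "x \<in> X"
  shows "(f ^^ n) x \<in> X"
  using assms by (induction n) auto

lemma continuous_on_funpow:
  assumes "continuous_on X f" "f \<in> X \<rightarrow> X"
  shows "continuous_on X (f ^^ n)"
proof (induction n)
  case (Suc n)
  have "(f ^^ n) ` X \<subseteq> X"
    using funpow_in[OF assms(2)] by auto
  then show ?case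
    using continuous_on_compose[OF Suc continuous_on_subset[OF assms(1)]] by simp
qed (simp add: id_def)

lemma uniformly_continuous_on_finitely_many_iterates:
  fixes X :: "'a::metric_space set"
  assumes "compact X" "continuous_on X f" "f \<in> X \<rightarrow> X" "e > 0"
  shows "\<exists>d>0. \<forall>n\<le>N. \<forall>x\<in>X. \<forall>y\<in>X. dist x y < d \<longrightarrow> dist ((f ^^ n) x) ((f ^^ n) y) < e"
proof -
  have "\<exists>d>0. \<forall>x\<in>X. \<forall>y\<in>X. dist x y < d \<longrightarrow> dist ((f ^^ n) x) ((f ^^ n) y) < e" for n
    using compact_uniformly_continuous[OF continuous_on_funpow[OF assms(2,3)] assms(1)] assms(4)
    unfolding uniformly_continuous_on_def by (metis dist_commute)
  then obtain d where d: "\<And>n. d n > 0"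
    "\<And>n x y. x \<in> X \<Longrightarrow> y \<in> X \<Longrightarrow> dist x y < d n \<Longrightarrow> dist ((f ^^ n) x) ((f ^^ n) y) < e"
    by metis
  show ?thesis
  proof (intro exI[of _ "Min (d ` {..N})"] conjI allI impI ballI)
    show "Min (d ` {..N}) > 0"
      using d(1) by (subst Min_gr_iff) auto
  qed (auto intro!: d(2))
qed

text \<open>
  The pairs of points at distance at least \<open>r\<close> that stay within \<open>r\<close> of each other at all
  the times \<open>1, \<dots>, N\<close> form a compact set, and no pair belongs to all these sets: by
  injectivity the images of the two points still differ, so expansivity separates them
  at some time \<open>\<ge> 1\<close>. By the finite intersection property one of the sets is empty.
\<close>

lemma recurrent_separation:
  fixes X :: "'a::metric_space set"
  assumes "compact X" "continuous_on X f" "f \<in> X \<rightarrow> X" "inj_on f X" "r > 0"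
    and expansive: "\<And>x y. x \<in> X \<Longrightarrow> y \<in> X \<Longrightarrow> x \<noteq> y \<Longrightarrow> \<exists>n. dist ((f ^^ n) x) ((f ^^ n) y) > r"
  shows "\<exists>N. \<forall>x\<in>X. \<forall>y\<in>X. dist x y \<ge> r \<longrightarrow>
           (\<exists>n\<in>{1..N}. dist ((f ^^ n) x) ((f ^^ n) y) > r)"
proof -
  define D where "D n p = dist ((f ^^ n) (fst p)) ((f ^^ n) (snd p))" for n p
  define far where "far = {p \<in> X \<times> X. r \<le> D 0 p}"
  define near where "near n = {p \<in> X \<times> X. D n p \<le> r}" for n
  have cont: "continuous_on (X \<times> X) (D n)" for n
    unfolding D_def
    by (intro continuous_on_dist continuous_on_compose2[OF continuous_on_funpow[OF assms(2,3)]]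
        continuous_intros) auto
  have "closed (X \<times> X)"
    using assms(1) by (simp add: compact_Times compact_imp_closed)
  then have closed: "closed far" "closed (near n)" for n
    unfolding far_def near_def
    by (intro continuous_on_closed_Collect_le cont continuous_on_const; simp)+
  have "compact far"
  proof -
    have "far = X \<times> X \<inter> far"
      by (auto simp: far_def)
    then show ?thesis
      using assms(1) closed(1) by (metis compact_Int_closed compact_Times)
  qed
  moreover have "far \<inter> (\<Inter>n\<in>{1..}. near n) = {}"
  proof (rule equals0I)
    fix p assume p: "p \<in> far \<inter> (\<Inter>n\<in>{1..}. near n)"
    obtain x y where xy: "p = (x, y)" by (cases p)
    have "x \<in> X" "y \<in> X" "x \<noteq> y"
      using p assms(5) by (auto simp: far_def D_def xy)
    then have "f x \<in> X" "f y \<in> X" "f x \<noteq> f y"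
      using assms(3,4) by (auto dest: inj_onD)
    then obtain n where "dist ((f ^^ n) (f x)) ((f ^^ n) (f y)) > r"
      using expansive by blast
    then have "D (Suc n) p > r"
      by (simp add: D_def xy funpow_swap1)
    moreover have "p \<in> near (Suc n)"
      using p by simp
    ultimately show False
      by (simp add: near_def)
  qed
  ultimately obtain I where I: "finite I" "I \<subseteq> {1..}" "far \<inter> (\<Inter>n\<in>I. near n) = {}"
    using compact_imp_fip_image[of far "{1..}" near] closed(2) by metis
  show ?thesis
  proof (intro exI[of _ "Max (insert 0 I)"] ballI impI)
    fix x y assume *: "x \<in> X" "y \<in> X" "r \<le> dist x y"
    then have "(x, y) \<in> far"
      by (simp add: far_def D_def)
    with I(3) obtain n where n: "n \<in> I" "(x, y) \<notin> near n"
      by blast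
    then have "dist ((f ^^ n) x) ((f ^^ n) y) > r"
      using * by (auto simp: near_def D_def)
    moreover have "n \<in> {1..Max (insert 0 I)}"
      using n(1) I(1,2) by auto
    ultimately show "\<exists>n\<in>{1..Max (insert 0 I)}. dist ((f ^^ n) x) ((f ^^ n) y) > r"
      by blast
  qed
qed

text \<open>
  Once the orbits have been more than \<open>r\<close> apart, this recurs with gaps of at most \<open>N\<close>.
  If \<open>m\<close> is the last such time up to \<open>n\<close>, the next one lies in \<open>{n<..n + N}\<close>. A distance
  at time \<open>n\<close> so small that it stays below \<open>r\<close> for \<open>N\<close> further steps rules this out.
\<close>

lemma close_now_imp_close_before:
  fixes X :: "'a::metric_space set"
  assumes "compact X" "continuous_on X f" "f \<in> X \<rightarrow> X" "inj_on f X" "r > 0"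
    and "\<And>x y. x \<in> X \<Longrightarrow> y \<in> X \<Longrightarrow> x \<noteq> y \<Longrightarrow> \<exists>n. dist ((f ^^ n) x) ((f ^^ n) y) > r"
  shows "\<exists>d>0. \<forall>x\<in>X. \<forall>y\<in>X. \<forall>n. dist ((f ^^ n) x) ((f ^^ n) y) < d \<longrightarrow>
           (\<forall>i\<le>n. dist ((f ^^ i) x) ((f ^^ i) y) \<le> r)"
proof -
  obtain N where N: "\<And>x y. x \<in> X \<Longrightarrow> y \<in> X \<Longrightarrow> dist x y \<ge> r \<Longrightarrow>
      \<exists>n\<in>{1..N}. dist ((f ^^ n) x) ((f ^^ n) y) > r"
    using recurrent_separation[OF assms] by blast
  obtain d where d: "d > 0" "\<And>n x y. n \<le> N \<Longrightarrow> x \<in> X \<Longrightarrow> y \<in> X \<Longrightarrow> dist x y < d \<Longrightarrow>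
      dist ((f ^^ n) x) ((f ^^ n) y) < r"
    using uniformly_continuous_on_finitely_many_iterates[OF assms(1-3,5), of N] by blast
  have "dist ((f ^^ i) x) ((f ^^ i) y) \<le> r"
    if xy: "x \<in> X" "y \<in> X" and close: "dist ((f ^^ n) x) ((f ^^ n) y) < d" and "i \<le> n"
    for x y n i
  proof (rule ccontr)
    define apart where "apart j \<longleftrightarrow> dist ((f ^^ j) x) ((f ^^ j) y) > r" for j
    assume "\<not> dist ((f ^^ i) x) ((f ^^ i) y) \<le> r"
    then have i: "apart i \<and> i \<le> n"
      using \<open>i \<le> n\<close> by (simp add: apart_def)
    define m where "m = (GREATEST j. apart j \<and> j \<le> n)"
    have m: "apart m" "m \<le> n"
      using GreatestI_nat[of "\<lambda>j. apart j \<and> j \<le> n", OF i] by (auto simp: m_def)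
    have last: "j \<le> m" if "apart j" "j \<le> n" for j
      using Greatest_le_nat[of "\<lambda>j. apart j \<and> j \<le> n" j n] that by (auto simp: m_def)
    obtain k where k: "k \<in> {1..N}" "apart (k + m)"
      using N[of "(f ^^ m) x" "(f ^^ m) y"] m(1) funpow_in[OF assms(3)] xy
      by (auto simp: apart_def funpow_add)
    have "k + m > n"
      using last[of "k + m"] k by force
    then obtain l where l: "k + m = l + n" "l \<le> N"
      using k(1) m(2) by (intro that[of "k + m - n"]) auto
    have "\<not> apart (l + n)"
      using d(2)[OF l(2) funpow_in[OF assms(3) xy(1)] funpow_in[OF assms(3) xy(2)] close]
      by (simp add: apart_def funpow_add)
    then show False
      using k(2) l(1) by simp
  qed
  then show ?thesis
    using d(1) by blast
qed

lemma finite_if_positively_expansive_inj: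
  fixes X :: "'a::metric_space set"
  assumes "compact X" "inj_on f X" "positively_expansive_on X f"
  shows "finite X"
proof (rule ccontr)
  assume "infinite X"
  obtain r where f: "continuous_on X f" "f \<in> X \<rightarrow> X" and r: "r > 0"
    "\<And>x y. x \<in> X \<Longrightarrow> y \<in> X \<Longrightarrow> x \<noteq> y \<Longrightarrow> \<exists>n. dist ((f ^^ n) x) ((f ^^ n) y) > r"
    using assms(3) unfolding positively_expansive_on_def by blast
  obtain d where d: "d > 0"
    "\<And>x y n i. x \<in> X \<Longrightarrow> y \<in> X \<Longrightarrow> dist ((f ^^ n) x) ((f ^^ n) y) < d \<Longrightarrow> i \<le> n \<Longrightarrow>
       dist ((f ^^ i) x) ((f ^^ i) y) \<le> r"
    using close_now_imp_close_before[OF assms(1) f assms(2) r] by blast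
  obtain C where C: "finite C" "X \<subseteq> (\<Union>c\<in>C. ball c (d / 2))"
    using assms(1) d(1) unfolding compact_eq_totally_bounded by (meson half_gt_zero)
  obtain S where S: "finite S" "card S = Suc (card C)" "S \<subseteq> X"
    using infinite_arbitrarily_large[OF \<open>infinite X\<close>] by blast
  obtain t where t: "\<And>x y. x \<in> X \<Longrightarrow> y \<in> X \<Longrightarrow> x \<noteq> y \<Longrightarrow>
      dist ((f ^^ t x y) x) ((f ^^ t x y) y) > r"
    using r(2) by metis
  define n where "n = Max (case_prod t ` (S \<times> S))"
  have "\<forall>x\<in>S. \<exists>c\<in>C. (f ^^ n) x \<in> ball c (d / 2)"
    using C(2) S(3) funpow_in[OF f(2)] by blast
  then obtain c where c: "\<And>x. x \<in> S \<Longrightarrow> c x \<in> C" "\<And>x. x \<in> S \<Longrightarrow> dist (c x) ((f ^^ n) x) < d / 2"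
    by (metis mem_ball)
  have "card (c ` S) < card S"
    using card_mono[OF C(1) image_subsetI[of S c C]] c(1) S(2) by simp
  then obtain x y where xy: "x \<in> S" "y \<in> S" "x \<noteq> y" "c x = c y"
    using pigeonhole[of c S] unfolding inj_on_def by blast
  have "dist ((f ^^ n) x) ((f ^^ n) y) < d"
    using c(2)[OF xy(1)] c(2)[OF xy(2)] unfolding xy(4) by (rule dist_triangle_half_r)
  moreover have "t x y \<le> n"
    unfolding n_def using S(1) xy by (auto intro!: Max_ge)
  ultimately have "dist ((f ^^ t x y) x) ((f ^^ t x y) y) \<le> r"
    using d(2) xy S(3) by blast
  then show False
    using t[of x y] xy S(3) by force
qed

lemma positively_expansive_on_finite:
  fixes X :: "'a::metric_space set"
  assumes "finite X" "f \<in> X \<rightarrow> X"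
  shows "positively_expansive_on X f"
proof -
  define distances where "distances = {dist x y |x y. x \<in> X \<and> y \<in> X \<and> x \<noteq> y}"
  have "finite distances"
    using finite_image_set2[of "\<lambda>x. x \<in> X" "\<lambda>y. y \<in> X" dist] assms(1)
    unfolding distances_def by (auto elim!: rev_finite_subset)
  \<comment> \<open>The extra element \<open>1\<close> covers the spaces with at most one point.\<close>
  define r where "r = Min (insert 1 distances)"
  have "r > 0"
    using \<open>finite distances\<close> by (auto simp: r_def distances_def)
  moreover have "dist ((f ^^ 0) x) ((f ^^ 0) y) > r / 2" if "x \<in> X" "y \<in> X" "x \<noteq> y" for x y
  proof -
    have "r \<le> dist x y"
      unfolding r_def using \<open>finite distances\<close> that by (intro Min_le) (auto simp: distances_def)
    then show ?thesis
      using \<open>r > 0\<close> by simp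
  qed
  ultimately show ?thesis
    unfolding positively_expansive_on_def
    using assms by (meson continuous_on_finite half_gt_zero)
qed

theorem theorem1:
  fixes X :: "'a::metric_space set" and f :: "'a \<Rightarrow> 'a"
  assumes "compact X"
    and "\<exists>g. homeomorphism X X f g"
  shows "positively_expansive_on X f \<longleftrightarrow> finite X"
proof -
  have "inj_on f X" "f \<in> X \<rightarrow> X"
    using assms(2) by (auto simp: homeomorphism_def intro: inj_on_inverseI)
  then show ?thesis
    using finite_if_positively_expansive_inj[OF assms(1)] positively_expansive_on_finite by blast
qed

end
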